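(* Let $K$ be a field, $R=K[x_1,\ldots,x_n]$, and let $I$ and $J$ be two monomial ideals of $R$. Then $I\cap J=IJ$ if and only if $\operatorname{supp}(G(I))\cap \operatorname{supp}(G(J))=\emptyset$.
   Context: A monomial ideal of $R$ is an ideal generated by monomials. Each monomial ideal $I$ has a unique minimal monomial set of generators, denoted $G(I)$. For a set $T$ of monomials of $R$, $\operatorname{supp}(T)=\{i \mid x_i \text{ divides } m \text{ for some } m\in T\}$ (so $\operatorname{supp}(\emptyset)=\emptyset$). *)

theory Defs
  imports "HOL-Library.Poly_Mapping" "HOL-Algebra.Ideal_Product" "HOL-Algebra.Divisibility"
begin

text \<open>
  An exponent vector is a finitely supported function from variable indices to exponents, and a
  polynomial is a finitely supported function from exponent vectors to coefficients; the product
  on this type is the convolution product.  \<open>K[x\<^sub>1,\<dots>,x\<^sub>n]\<close> consists of the polynomials in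
  which only the variables with indices in \<open>{1..n}\<close> occur.
\<close>

definition poly_ring :: "nat \<Rightarrow> ((nat \<Rightarrow>\<^sub>0 nat) \<Rightarrow>\<^sub>0 'k::field) ring" where
  "poly_ring n =
     \<lparr>carrier = {p. \<forall>e \<in> Poly_Mapping.keys p. Poly_Mapping.keys e \<subseteq> {1..n}},
      monoid.mult = (*), one = 1, zero = 0, add = (+)\<rparr>"

definition monomials :: "nat \<Rightarrow> ((nat \<Rightarrow>\<^sub>0 nat) \<Rightarrow>\<^sub>0 'k::field) set" where
  "monomials n = {Poly_Mapping.single e 1 | e. Poly_Mapping.keys e \<subseteq> {1..n}}"

definition var :: "nat \<Rightarrow> (nat \<Rightarrow>\<^sub>0 nat) \<Rightarrow>\<^sub>0 'k::field" where
  "var i = Poly_Mapping.single (Poly_Mapping.single i 1) 1"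

definition monomial_ideal :: "nat \<Rightarrow> ((nat \<Rightarrow>\<^sub>0 nat) \<Rightarrow>\<^sub>0 'k::field) set \<Rightarrow> bool" where
  "monomial_ideal n I \<longleftrightarrow> (\<exists>S \<subseteq> monomials n. I = Idl\<^bsub>poly_ring n\<^esub> S)"

text \<open>Minimality is with respect to inclusion.\<close>

definition is_min_gens ::
  "nat \<Rightarrow> ((nat \<Rightarrow>\<^sub>0 nat) \<Rightarrow>\<^sub>0 'k::field) set \<Rightarrow> ((nat \<Rightarrow>\<^sub>0 nat) \<Rightarrow>\<^sub>0 'k) set \<Rightarrow> bool" where
  "is_min_gens n I S \<longleftrightarrow>
     S \<subseteq> monomials n \<and> Idl\<^bsub>poly_ring n\<^esub> S = I \<and> (\<forall>T. T \<subset> S \<longrightarrow> Idl\<^bsub>poly_ring n\<^esub> T \<noteq> I)"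

text \<open>The set \<open>G(I)\<close>; the description is proper because a monomial ideal has exactly one minimal
  monomial generating set, namely its divisibility-minimal monomials.\<close>

definition min_gens ::
  "nat \<Rightarrow> ((nat \<Rightarrow>\<^sub>0 nat) \<Rightarrow>\<^sub>0 'k::field) set \<Rightarrow> ((nat \<Rightarrow>\<^sub>0 nat) \<Rightarrow>\<^sub>0 'k) set" where
  "min_gens n I = (THE S. is_min_gens n I S)"

definition supp :: "nat \<Rightarrow> ((nat \<Rightarrow>\<^sub>0 nat) \<Rightarrow>\<^sub>0 'k::field) set \<Rightarrow> nat set" where
  "supp n T = {i \<in> {1..n}. \<exists>m \<in> T. var i divides\<^bsub>poly_ring n\<^esub> m}"

lemma poly_ring_cring: "cring (poly_ring n :: ((nat \<Rightarrow>\<^sub>0 nat) \<Rightarrow>\<^sub>0 'k::field) ring)"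
proof -
  let ?R = "poly_ring n :: ((nat \<Rightarrow>\<^sub>0 nat) \<Rightarrow>\<^sub>0 'k) ring"
  have ops: "x \<oplus>\<^bsub>?R\<^esub> y = x + y" "x \<otimes>\<^bsub>?R\<^esub> y = x * y" "\<zero>\<^bsub>?R\<^esub> = 0" "\<one>\<^bsub>?R\<^esub> = 1" for x y
    by (simp_all add: poly_ring_def)
  have mem: "p \<in> carrier ?R \<longleftrightarrow> (\<forall>e \<in> Poly_Mapping.keys p. Poly_Mapping.keys e \<subseteq> {1..n})" for p
    by (simp add: poly_ring_def)
  have add: "p + q \<in> carrier ?R" if "p \<in> carrier ?R" "q \<in> carrier ?R" for p q
    using that Poly_Mapping.keys_add[of p q] unfolding mem by blast
  have mult: "p * q \<in> carrier ?R" if p: "p \<in> carrier ?R" and q: "q \<in> carrier ?R" for p q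
    unfolding mem
  proof
    fix e assume "e \<in> Poly_Mapping.keys (p * q)"
    then obtain a b where "e = a + b" "a \<in> Poly_Mapping.keys p" "b \<in> Poly_Mapping.keys q"
      using keys_mult[of p q] by blast
    then show "Poly_Mapping.keys e \<subseteq> {1..n}"
      using p q Poly_Mapping.keys_add[of a b] unfolding mem by blast
  qed
  have neg: "- p \<in> carrier ?R" if "p \<in> carrier ?R" for p
    using that unfolding mem by simp
  have zero: "0 \<in> carrier ?R" and one: "1 \<in> carrier ?R"
    unfolding mem by simp_all
  show ?thesis
  proof (rule cringI)
    show "abelian_group ?R"
    proof (rule abelian_groupI)
      fix p assume "p \<in> carrier ?R"
      then show "\<exists>q\<in>carrier ?R. q \<oplus>\<^bsub>?R\<^esub> p = \<zero>\<^bsub>?R\<^esub>"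
        using neg by (intro bexI[of _ "- p"]) (simp_all add: ops)
    qed (simp_all only: ops add zero ac_simps add_0_left add_0_right)
    show "comm_monoid ?R"
      by (rule comm_monoidI) (simp_all only: ops mult one ac_simps mult_1_left mult_1_right)
  qed (simp only: ops distrib_right)
qed

end

theory Submission
  imports Defs
begin

text \<open>
  Membership in a monomial ideal is decided on exponent vectors: a polynomial lies in it iff each
  of its exponent vectors lies above one of the generators.  So \<open>I \<inter> J = IJ\<close> says that for all
  \<open>u \<in> G(I)\<close>, \<open>v \<in> G(J)\<close> some \<open>u' v'\<close> with \<open>u' \<in> G(I)\<close>, \<open>v' \<in> G(J)\<close> divides \<open>lcm(u, v)\<close>.  This
  is clear if the supports are disjoint.  Conversely, take \<open>u, v\<close> not coprime with \<open>L = lcm(u, v)\<close>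
  of least degree, and \<open>u' v'\<close> dividing \<open>L\<close>.  If \<open>u'\<close> and \<open>v\<close> were coprime, then \<open>u'\<close> would divide
  \<open>u\<close>, so \<open>u' = u\<close>, a contradiction; hence \<open>lcm(u', v) = L\<close> by minimality, and likewise
  \<open>lcm(u, v') = L\<close>.  If \<open>u'\<close> and \<open>v'\<close> were not coprime, \<open>lcm(u', v')\<close> would be a proper divisor of
  \<open>L\<close>; so they are coprime.  Comparing exponents variable by variable, \<open>u'\<close> divides \<open>u\<close> and \<open>v'\<close>
  divides \<open>v\<close>, whence \<open>u' = u\<close> and \<open>v' = v\<close>, which contradicts coprimality.
\<close>

section \<open>Exponent vectors\<close>

definition exp_dvd :: "('a \<Rightarrow>\<^sub>0 nat) \<Rightarrow> ('a \<Rightarrow>\<^sub>0 nat) \<Rightarrow> bool" (infix \<open>\<preceq>\<close> 50) where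
  "a \<preceq> b \<longleftrightarrow> (\<forall>i. Poly_Mapping.lookup a i \<le> Poly_Mapping.lookup b i)"

text \<open>Subtraction of naturals is truncated, so each coordinate of the sum is a maximum; this
  form inherits finite support from \<open>+\<close> and \<open>-\<close>.\<close>

definition exp_lcm :: "('a \<Rightarrow>\<^sub>0 nat) \<Rightarrow> ('a \<Rightarrow>\<^sub>0 nat) \<Rightarrow> ('a \<Rightarrow>\<^sub>0 nat)" where
  "exp_lcm a b = a + (b - a)"

text \<open>The total degree, which grows strictly under proper divisibility and so serves as the
  measure for inductions.\<close>

definition exp_deg :: "('a \<Rightarrow>\<^sub>0 nat) \<Rightarrow> nat" where
  "exp_deg a = (\<Sum>i\<in>Poly_Mapping.keys a. Poly_Mapping.lookup a i)"

text \<open>If \<open>E\<close> holds the exponents of some monomial generating set of an ideal,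
  these are the exponents of its minimal one.\<close>

definition min_exps :: "('a \<Rightarrow>\<^sub>0 nat) set \<Rightarrow> ('a \<Rightarrow>\<^sub>0 nat) set" where
  "min_exps E = {e \<in> E. \<forall>a\<in>E. a \<preceq> e \<longrightarrow> a = e}"

lemma lookup_exp_lcm:
  "Poly_Mapping.lookup (exp_lcm a b) i = max (Poly_Mapping.lookup a i) (Poly_Mapping.lookup b i)"
  by (simp add: exp_lcm_def lookup_add lookup_minus)

lemma exp_dvd_refl [simp]: "a \<preceq> a"
  by (simp add: exp_dvd_def)

lemma exp_dvd_trans: "a \<preceq> b \<Longrightarrow> b \<preceq> c \<Longrightarrow> a \<preceq> c"
  unfolding exp_dvd_def using le_trans by blast

lemma exp_dvd_antisym: "a \<preceq> b \<Longrightarrow> b \<preceq> a \<Longrightarrow> a = b"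
  by (rule poly_mapping_eqI) (auto simp: exp_dvd_def intro: antisym)

lemma exp_dvd_add [simp]: "a \<preceq> a + b" "a \<preceq> b + a"
  by (simp_all add: exp_dvd_def lookup_add)

lemma exp_dvd_diff_add: "a \<preceq> b \<Longrightarrow> (b - a) + a = b"
  by (rule poly_mapping_eqI) (simp add: exp_dvd_def lookup_add lookup_minus)

lemma exp_dvd_lcm [simp]: "a \<preceq> exp_lcm a b" "b \<preceq> exp_lcm a b"
  by (simp_all add: exp_dvd_def lookup_exp_lcm)

lemma exp_lcm_least: "a \<preceq> c \<Longrightarrow> b \<preceq> c \<Longrightarrow> exp_lcm a b \<preceq> c"
  by (simp add: exp_dvd_def lookup_exp_lcm)

lemma keys_mono_exp_dvd: "a \<preceq> b \<Longrightarrow> Poly_Mapping.keys a \<subseteq> Poly_Mapping.keys b"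
  unfolding exp_dvd_def in_keys_iff subset_iff by (metis le_zero_eq)

lemma exp_deg_less:
  assumes "a \<preceq> b" and "a \<noteq> b"
  shows "exp_deg a < exp_deg b"
proof -
  have le: "Poly_Mapping.lookup a i \<le> Poly_Mapping.lookup b i" for i
    using assms(1) by (simp add: exp_dvd_def)
  obtain i where i: "Poly_Mapping.lookup a i \<noteq> Poly_Mapping.lookup b i"
    using assms(2) by (metis poly_mapping_eqI)
  have lt: "Poly_Mapping.lookup a i < Poly_Mapping.lookup b i"
    using i le[of i] by linarith
  \<comment> \<open>Both degrees are compared as sums over the larger support; the terms added for
    \<open>a\<close> are zero.\<close>
  have "exp_deg a = (\<Sum>i\<in>Poly_Mapping.keys b. Poly_Mapping.lookup a i)"
    unfolding exp_deg_def using keys_mono_exp_dvd[OF assms(1)]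
    by (intro sum.mono_neutral_left) (auto simp: in_keys_iff)
  also have "\<dots> < exp_deg b"
    unfolding exp_deg_def using le lt
    by (intro sum_strict_mono_ex1) (auto simp: in_keys_iff intro!: bexI[of _ i])
  finally show ?thesis .
qed

text \<open>Descent: a non-minimal \<open>e\<close> has a proper divisor in \<open>E\<close>, of
  smaller degree, so the process ends even if \<open>E\<close> is infinite.\<close>

lemma min_exps_below:
  assumes "e \<in> E"
  shows "\<exists>a\<in>min_exps E. a \<preceq> e"
  using assms
proof (induction "exp_deg e" arbitrary: e rule: less_induct)
  case less
  show ?case
  proof (cases "e \<in> min_exps E")
    case False
    then obtain a where a: "a \<in> E" "a \<preceq> e" "a \<noteq> e"
      using less.prems by (auto simp: min_exps_def)
    then show ?thesis
      using less.hyps[of a] exp_deg_less[of a e] exp_dvd_trans by blast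
  next
    case True
    then show ?thesis using exp_dvd_refl by blast
  qed
qed

lemma min_exps_antichain: "a \<in> min_exps E \<Longrightarrow> b \<in> min_exps E \<Longrightarrow> a \<preceq> b \<Longrightarrow> a = b"
  by (simp add: min_exps_def)

text \<open>Core of the forward direction: \<open>G\<close> and \<open>H\<close> stand for the
  exponents of the two minimal generating sets, and \<open>prod\<close> is what the inclusion of the
  intersection in the product says about them. The choice of an lcm of least degree becomes an
  induction on that degree.\<close>

lemma antichains_disjoint_keys:
  fixes G H :: "('a \<Rightarrow>\<^sub>0 nat) set"
  assumes G: "\<And>a b. a \<in> G \<Longrightarrow> b \<in> G \<Longrightarrow> a \<preceq> b \<Longrightarrow> a = b"
    and H: "\<And>a b. a \<in> H \<Longrightarrow> b \<in> H \<Longrightarrow> a \<preceq> b \<Longrightarrow> a = b"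
    and prod: "\<And>u v. u \<in> G \<Longrightarrow> v \<in> H \<Longrightarrow> \<exists>u'\<in>G. \<exists>v'\<in>H. u' + v' \<preceq> exp_lcm u v"
    and "u \<in> G" and "v \<in> H"
  shows "Poly_Mapping.keys u \<inter> Poly_Mapping.keys v = {}"
  using \<open>u \<in> G\<close> \<open>v \<in> H\<close>
proof (induction "exp_deg (exp_lcm u v)" arbitrary: u v rule: less_induct)
  case less
  define L where "L = exp_lcm u v"
  obtain u' v' where u': "u' \<in> G" and v': "v' \<in> H" and sum: "u' + v' \<preceq> L"
    using prod less.prems unfolding L_def by blast
  have u'L: "u' \<preceq> L" and v'L: "v' \<preceq> L"
    using sum exp_dvd_add exp_dvd_trans by blast+
  have uL: "u \<preceq> L" and vL: "v \<preceq> L"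
    by (simp_all add: L_def)
  \<comment> \<open>If the lcm were a proper divisor of \<open>L\<close>, its degree would be
    smaller, and the induction hypothesis would make \<open>a\<close> and \<open>b\<close>
    coprime.\<close>
  have min: "exp_lcm a b = L"
    if "a \<in> G" "b \<in> H" "a \<preceq> L" "b \<preceq> L" "Poly_Mapping.keys a \<inter> Poly_Mapping.keys b \<noteq> {}" for a b
    using less.hyps[of a b] exp_deg_less[of "exp_lcm a b" L] exp_lcm_least[of a L b] that L_def
    by blast
  have max_L: "Poly_Mapping.lookup L i = max (Poly_Mapping.lookup u i) (Poly_Mapping.lookup v i)" for i
    by (simp add: L_def lookup_exp_lcm)
  have coprimeD: "Poly_Mapping.lookup a i = 0 \<or> Poly_Mapping.lookup b i = 0"
    if "Poly_Mapping.keys a \<inter> Poly_Mapping.keys b = {}" for a b :: "'a \<Rightarrow>\<^sub>0 nat" and i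
    using that by (auto simp: in_keys_iff)
  have dvdD: "Poly_Mapping.lookup a i \<le> Poly_Mapping.lookup b i" if "a \<preceq> b" for a b :: "'a \<Rightarrow>\<^sub>0 nat" and i
    using that by (simp add: exp_dvd_def)
  show ?case
  proof (rule ccontr)
    assume non_coprime: "Poly_Mapping.keys u \<inter> Poly_Mapping.keys v \<noteq> {}"
    have "Poly_Mapping.keys u' \<inter> Poly_Mapping.keys v \<noteq> {}"
    proof
      assume cop: "Poly_Mapping.keys u' \<inter> Poly_Mapping.keys v = {}"
      \<comment> \<open>Where \<open>u'\<close> is nonzero, \<open>v\<close> vanishes, so
        \<open>L\<close> agrees with \<open>u\<close> there and bounds \<open>u'\<close>.\<close>
      have "u' \<preceq> u"
        unfolding exp_dvd_def
      proof
        fix i show "Poly_Mapping.lookup u' i \<le> Poly_Mapping.lookup u i"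
          using coprimeD[OF cop, of i] dvdD[OF u'L, of i] max_L[of i] by auto
      qed
      then show False using G[OF u' less.prems(1)] cop non_coprime by simp
    qed
    then have L1: "exp_lcm u' v = L" using min u' less.prems(2) u'L vL by blast
    have "Poly_Mapping.keys u \<inter> Poly_Mapping.keys v' \<noteq> {}"
    proof
      assume cop: "Poly_Mapping.keys u \<inter> Poly_Mapping.keys v' = {}"
      have "v' \<preceq> v"
        unfolding exp_dvd_def
      proof
        fix i show "Poly_Mapping.lookup v' i \<le> Poly_Mapping.lookup v i"
          using coprimeD[OF cop, of i] dvdD[OF v'L, of i] max_L[of i] by auto
      qed
      then show False using H[OF v' less.prems(2)] cop non_coprime by simp
    qed
    then have L2: "exp_lcm u v' = L" using min v' less.prems(1) uL v'L by blast
    have cop: "Poly_Mapping.keys u' \<inter> Poly_Mapping.keys v' = {}"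
    proof (rule ccontr)
      assume nc: "Poly_Mapping.keys u' \<inter> Poly_Mapping.keys v' \<noteq> {}"
      then have "exp_lcm u' v' = L" using min u' v' u'L v'L by blast
      \<comment> \<open>At a shared variable \<open>u' + v'\<close> exceeds the maximum of its two
        summands, which would be the exponent of \<open>L\<close>, against
        \<open>sum\<close>.\<close>
      moreover obtain i where "Poly_Mapping.lookup u' i \<noteq> 0" "Poly_Mapping.lookup v' i \<noteq> 0"
        using nc by (auto simp: in_keys_iff)
      ultimately show False
        using dvdD[OF sum, of i] lookup_exp_lcm[of u' v' i] by (auto simp: lookup_add)
    qed
    \<comment> \<open>By \<open>cop\<close>, one of \<open>u'\<close>, \<open>v'\<close> vanishes at
      \<open>i\<close>. If \<open>u'\<close> does, \<open>L1\<close> makes \<open>v\<close> agree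
      with \<open>L\<close> there, and \<open>L2\<close> bounds \<open>v'\<close> by
      \<open>L\<close>; the other case is symmetric.\<close>
    have cmp: "Poly_Mapping.lookup u' i \<le> Poly_Mapping.lookup u i \<and>
               Poly_Mapping.lookup v' i \<le> Poly_Mapping.lookup v i" for i
      using coprimeD[OF cop, of i] max_L[of i] lookup_exp_lcm[of u' v i] lookup_exp_lcm[of u v' i]
        L1 L2 by (auto simp: max_def split: if_splits)
    then have "u' \<preceq> u" "v' \<preceq> v" by (simp_all add: exp_dvd_def)
    then have "u' = u" "v' = v" using G H u' v' less.prems by blast+
    then show False using cop non_coprime by simp
  qed
qed

text \<open>In each variable at most one summand is nonzero. This carries the direction from
  disjoint supports.\<close>

lemma exp_dvd_add_coprime:
  assumes "a \<preceq> e" and "b \<preceq> e" and "Poly_Mapping.keys a \<inter> Poly_Mapping.keys b = {}"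
  shows "a + b \<preceq> e"
  unfolding exp_dvd_def
proof
  fix i
  have "Poly_Mapping.lookup a i = 0 \<or> Poly_Mapping.lookup b i = 0"
    using assms(3) by (auto simp: in_keys_iff)
  then show "Poly_Mapping.lookup (a + b) i \<le> Poly_Mapping.lookup e i"
    using assms(1,2) by (auto simp: exp_dvd_def lookup_add)
qed

section \<open>Monomial ideals\<close>

definition exps :: "nat \<Rightarrow> (nat \<Rightarrow>\<^sub>0 nat) set" where
  "exps n = {e. Poly_Mapping.keys e \<subseteq> {1..n}}"

definition xpow :: "(nat \<Rightarrow>\<^sub>0 nat) \<Rightarrow> (nat \<Rightarrow>\<^sub>0 nat) \<Rightarrow>\<^sub>0 'k::field" where
  "xpow e = Poly_Mapping.single e 1"

text \<open>A membership test on exponents for the ideal generated by the monomials with exponents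
  in \<open>E\<close>; \<open>Idl_xpow\<close> shows the agreement for \<open>E\<close> within
  \<open>exps n\<close>.\<close>

definition mon_span :: "nat \<Rightarrow> (nat \<Rightarrow>\<^sub>0 nat) set \<Rightarrow> ((nat \<Rightarrow>\<^sub>0 nat) \<Rightarrow>\<^sub>0 'k::field) set" where
  "mon_span n E = {p \<in> carrier (poly_ring n). \<forall>e\<in>Poly_Mapping.keys p. \<exists>a\<in>E. a \<preceq> e}"

lemma poly_ring_simps:
  "x \<oplus>\<^bsub>poly_ring n\<^esub> y = x + y" "x \<otimes>\<^bsub>poly_ring n\<^esub> y = x * y"
  "\<zero>\<^bsub>poly_ring n\<^esub> = 0" "\<one>\<^bsub>poly_ring n\<^esub> = 1"
  by (simp_all add: poly_ring_def)

lemma poly_ring_ring: "ring (poly_ring n)"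
  using poly_ring_cring cring.axioms(1) by blast

lemma carrier_poly_ring: "p \<in> carrier (poly_ring n) \<longleftrightarrow> Poly_Mapping.keys p \<subseteq> exps n"
  by (auto simp: poly_ring_def exps_def)

lemma exps_add: "a \<in> exps n \<Longrightarrow> b \<in> exps n \<Longrightarrow> a + b \<in> exps n"
  using Poly_Mapping.keys_add[of a b] by (auto simp: exps_def)

lemma exps_exp_dvd: "b \<in> exps n \<Longrightarrow> a \<preceq> b \<Longrightarrow> a \<in> exps n"
  using keys_mono_exp_dvd by (force simp: exps_def)

lemma exps_diff: "b \<in> exps n \<Longrightarrow> b - a \<in> exps n"
  by (erule exps_exp_dvd) (simp add: exp_dvd_def lookup_minus)

lemma exps_lcm: "a \<in> exps n \<Longrightarrow> b \<in> exps n \<Longrightarrow> exp_lcm a b \<in> exps n"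
  by (simp add: exp_lcm_def exps_add exps_diff)

lemma monomials_eq: "monomials n = xpow ` exps n"
  by (auto simp: monomials_def xpow_def exps_def)

lemma keys_xpow [simp]: "Poly_Mapping.keys (xpow e) = {e}"
  by (simp add: xpow_def)

lemma xpow_mult: "xpow a * xpow b = xpow (a + b)"
  by (simp add: xpow_def mult_single)

lemma xpow_in_span: "xpow e \<in> mon_span n E \<longleftrightarrow> e \<in> exps n \<and> (\<exists>a\<in>E. a \<preceq> e)"
  by (simp add: mon_span_def carrier_poly_ring)

lemma xpow_in_spanI: "e \<in> exps n \<Longrightarrow> a \<in> E \<Longrightarrow> a \<preceq> e \<Longrightarrow> xpow e \<in> mon_span n E"
  by (auto simp: xpow_in_span)

lemma xpow_in_span_self: "E \<subseteq> exps n \<Longrightarrow> e \<in> E \<Longrightarrow> xpow e \<in> mon_span n E"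
  by (rule xpow_in_spanI) auto

section \<open>Generated monomial ideals described by exponents\<close>

lemma mon_span_mult_left:
  fixes p x :: "((nat \<Rightarrow>\<^sub>0 nat) \<Rightarrow>\<^sub>0 'k::field)"
  assumes p: "p \<in> mon_span n E" and x: "x \<in> carrier (poly_ring n)"
  shows "x * p \<in> mon_span n E"
proof -
  interpret ring "poly_ring n :: ((nat \<Rightarrow>\<^sub>0 nat) \<Rightarrow>\<^sub>0 'k) ring" by (rule poly_ring_ring)
  have "x * p \<in> carrier (poly_ring n)"
    using m_closed[of x p] p x by (simp add: poly_ring_simps mon_span_def)
  moreover have "\<exists>a\<in>E. a \<preceq> e" if e: "e \<in> Poly_Mapping.keys (x * p)" for e
  proof -
    obtain c d where "e = c + d" "d \<in> Poly_Mapping.keys p"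
      using e keys_mult[of x p] by blast
    then show ?thesis
      using p exp_dvd_add(2)[of d c] exp_dvd_trans unfolding mon_span_def by blast
  qed
  ultimately show ?thesis by (simp add: mon_span_def)
qed

lemma mon_span_add: "p \<in> mon_span n E \<Longrightarrow> q \<in> mon_span n E \<Longrightarrow> p + q \<in> mon_span n E"
  using Poly_Mapping.keys_add[of p q] unfolding mon_span_def carrier_poly_ring by blast

lemma ideal_mon_span:
  "ideal (mon_span n E) (poly_ring n :: ((nat \<Rightarrow>\<^sub>0 nat) \<Rightarrow>\<^sub>0 'k::field) ring)"
proof (rule idealI)
  interpret R: cring "poly_ring n :: ((nat \<Rightarrow>\<^sub>0 nat) \<Rightarrow>\<^sub>0 'k) ring" by (rule poly_ring_cring)
  show "ring (poly_ring n :: ((nat \<Rightarrow>\<^sub>0 nat) \<Rightarrow>\<^sub>0 'k) ring)" by (rule poly_ring_ring)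
  show "subgroup (mon_span n E :: ((nat \<Rightarrow>\<^sub>0 nat) \<Rightarrow>\<^sub>0 'k) set) (add_monoid (poly_ring n))"
  proof (rule R.add.subgroupI)
    show "mon_span n E \<subseteq> carrier (poly_ring n :: ((nat \<Rightarrow>\<^sub>0 nat) \<Rightarrow>\<^sub>0 'k) ring)"
      by (auto simp: mon_span_def)
    have "(0 :: (nat \<Rightarrow>\<^sub>0 nat) \<Rightarrow>\<^sub>0 'k) \<in> mon_span n E"
      by (simp add: mon_span_def carrier_poly_ring)
    then show "mon_span n E \<noteq> ({} :: ((nat \<Rightarrow>\<^sub>0 nat) \<Rightarrow>\<^sub>0 'k) set)" by blast
    fix p q :: "(nat \<Rightarrow>\<^sub>0 nat) \<Rightarrow>\<^sub>0 'k"
    assume p: "p \<in> mon_span n E"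
    have "- p \<in> mon_span n E"
      using p by (simp add: mon_span_def carrier_poly_ring)
    \<comment> \<open>Negation in the ring record is the abstract additive inverse; uniqueness of
      inverses identifies it with negation on the type.\<close>
    moreover have "\<ominus>\<^bsub>poly_ring n\<^esub> p = - p"
      using p by (intro R.minus_equality)
        (simp_all add: poly_ring_simps mon_span_def carrier_poly_ring)
    ultimately show "\<ominus>\<^bsub>poly_ring n\<^esub> p \<in> mon_span n E" by simp
    assume "q \<in> mon_span n E"
    then show "p \<oplus>\<^bsub>poly_ring n\<^esub> q \<in> mon_span n E"
      using p by (simp add: poly_ring_simps mon_span_add)
  qed
next
  fix p x :: "(nat \<Rightarrow>\<^sub>0 nat) \<Rightarrow>\<^sub>0 'k"
  assume "p \<in> mon_span n E" "x \<in> carrier (poly_ring n)"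
  then have "x * p \<in> mon_span n E" by (rule mon_span_mult_left)
  then show "x \<otimes>\<^bsub>poly_ring n\<^esub> p \<in> mon_span n E" "p \<otimes>\<^bsub>poly_ring n\<^esub> x \<in> mon_span n E"
    by (simp_all add: poly_ring_simps mult.commute[of p x])
qed

lemma poly_eq_sum_single:
  fixes p :: "'a \<Rightarrow>\<^sub>0 'b::comm_monoid_add"
  shows "p = (\<Sum>e\<in>Poly_Mapping.keys p. Poly_Mapping.single e (Poly_Mapping.lookup p e))"
  by (rule poly_mapping_eqI) (simp add: lookup_sum lookup_single when_def in_keys_iff)

text \<open>A term of \<open>p\<close> with exponent \<open>e\<close> is a multiple of
  \<open>xpow a\<close> for some \<open>a\<close> in \<open>E\<close> below \<open>e\<close>, hence
  lies in \<open>A\<close>; and \<open>p\<close> is the finite sum of its terms.\<close>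

lemma mon_span_subset_ideal:
  fixes A :: "((nat \<Rightarrow>\<^sub>0 nat) \<Rightarrow>\<^sub>0 'k::field) set"
  assumes A: "ideal A (poly_ring n)" and gens: "xpow ` E \<subseteq> A"
  shows "mon_span n E \<subseteq> A"
proof
  interpret ideal A "poly_ring n" by (rule A)
  fix p :: "(nat \<Rightarrow>\<^sub>0 nat) \<Rightarrow>\<^sub>0 'k"
  assume p: "p \<in> mon_span n E"
  have term_in: "Poly_Mapping.single e (Poly_Mapping.lookup p e) \<in> A"
    if e: "e \<in> Poly_Mapping.keys p" for e
  proof -
    obtain a where a: "a \<in> E" "a \<preceq> e"
      using p e by (auto simp: mon_span_def)
    have "e - a \<in> exps n"
      using p e by (auto simp: mon_span_def carrier_poly_ring intro: exps_diff)
    then have "Poly_Mapping.single (e - a) (Poly_Mapping.lookup p e) \<in> carrier (poly_ring n)"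
      by (simp add: carrier_poly_ring)
    then have "Poly_Mapping.single (e - a) (Poly_Mapping.lookup p e) * xpow a \<in> A"
      using I_l_closed gens a(1) by (auto simp: poly_ring_simps)
    then show ?thesis
      by (simp add: xpow_def mult_single exp_dvd_diff_add[OF a(2)])
  qed
  \<comment> \<open>Generalised to subsets of the keys, with \<open>p\<close> fixed, so that finite
    induction applies.\<close>
  have "(\<Sum>e\<in>X. Poly_Mapping.single e (Poly_Mapping.lookup p e)) \<in> A"
    if "X \<subseteq> Poly_Mapping.keys p" for X
    using finite_subset[OF that finite_keys] that
  proof (induction X rule: finite_induct)
    case empty
    show ?case
      using additive_subgroup.zero_closed[OF is_additive_subgroup] by (simp add: poly_ring_simps)
  next
    case (insert e X)
    then show ?case
      using additive_subgroup.a_closed[OF is_additive_subgroup] term_in by (simp add: poly_ring_simps)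
  qed
  then show "p \<in> A" by (metis poly_eq_sum_single order_refl)
qed

lemma Idl_xpow:
  assumes "E \<subseteq> exps n"
  shows "Idl\<^bsub>poly_ring n\<^esub> (xpow ` E) = (mon_span n E :: ((nat \<Rightarrow>\<^sub>0 nat) \<Rightarrow>\<^sub>0 'k::field) set)"
    (is "?I = ?S")
proof -
  interpret ring "poly_ring n :: ((nat \<Rightarrow>\<^sub>0 nat) \<Rightarrow>\<^sub>0 'k) ring" by (rule poly_ring_ring)
  have carr: "xpow ` E \<subseteq> carrier (poly_ring n :: ((nat \<Rightarrow>\<^sub>0 nat) \<Rightarrow>\<^sub>0 'k) ring)"
    using assms by (auto simp: carrier_poly_ring)
  show ?thesis
  proof
    have "xpow ` E \<subseteq> ?S"
      using assms by (auto intro: xpow_in_span_self)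
    then show "?I \<subseteq> ?S"
      by (rule genideal_minimal[OF ideal_mon_span])
    show "?S \<subseteq> ?I"
      by (rule mon_span_subset_ideal[OF genideal_ideal[OF carr] genideal_self[OF carr]])
  qed
qed

section \<open>Inclusions and minimal generating sets of monomial ideals\<close>

lemma mon_span_subset_iff:
  assumes "E \<subseteq> exps n"
  shows "(mon_span n E :: ((nat \<Rightarrow>\<^sub>0 nat) \<Rightarrow>\<^sub>0 'k::field) set) \<subseteq> mon_span n F
    \<longleftrightarrow> (\<forall>e\<in>E. \<exists>a\<in>F. a \<preceq> e)" (is "?S \<subseteq> ?T \<longleftrightarrow> ?R")
proof
  assume sub: "?S \<subseteq> ?T"
  show ?R
  proof
    fix e assume "e \<in> E"
    then have "(xpow e :: (nat \<Rightarrow>\<^sub>0 nat) \<Rightarrow>\<^sub>0 'k) \<in> ?S"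
      using assms by (auto intro: xpow_in_span_self)
    then have "(xpow e :: (nat \<Rightarrow>\<^sub>0 nat) \<Rightarrow>\<^sub>0 'k) \<in> ?T" using sub by blast
    then show "\<exists>a\<in>F. a \<preceq> e" by (simp add: xpow_in_span)
  qed
next
  assume ?R
  then show "?S \<subseteq> ?T"
    unfolding mon_span_def using exp_dvd_trans by blast
qed

lemma mon_span_min_exps:
  assumes "E \<subseteq> exps n"
  shows "mon_span n (min_exps E) = (mon_span n E :: ((nat \<Rightarrow>\<^sub>0 nat) \<Rightarrow>\<^sub>0 'k::field) set)"
proof (rule antisym)
  have "min_exps E \<subseteq> exps n" using assms by (auto simp: min_exps_def)
  then show "mon_span n (min_exps E) \<subseteq> mon_span n E"
    by (subst mon_span_subset_iff) (auto simp: min_exps_def intro: exp_dvd_refl)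
  show "mon_span n E \<subseteq> mon_span n (min_exps E)"
    using assms min_exps_below by (subst mon_span_subset_iff) auto
qed

text \<open>Descending from a minimal \<open>e\<close> to some \<open>a\<close> in \<open>F\<close>,
  and from there to some \<open>b\<close> in \<open>E\<close>, leads back to \<open>e\<close> by
  minimality, so \<open>a = e\<close>.\<close>

lemma min_exps_subset:
  assumes E: "E \<subseteq> exps n" and F: "F \<subseteq> exps n"
    and span: "mon_span n E = (mon_span n F :: ((nat \<Rightarrow>\<^sub>0 nat) \<Rightarrow>\<^sub>0 'k::field) set)"
  shows "min_exps E \<subseteq> F"
proof
  fix e assume e: "e \<in> min_exps E"
  have EF: "\<forall>e\<in>E. \<exists>a\<in>F. a \<preceq> e" and FE: "\<forall>e\<in>F. \<exists>a\<in>E. a \<preceq> e"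
    using mon_span_subset_iff[OF E, where 'k = 'k, of F]
      mon_span_subset_iff[OF F, where 'k = 'k, of E] span by simp_all
  obtain a where a: "a \<in> F" "a \<preceq> e" using EF e by (auto simp: min_exps_def)
  obtain b where b: "b \<in> E" "b \<preceq> a" using FE a by blast
  have "b = e" using e b a exp_dvd_trans by (auto simp: min_exps_def)
  then show "e \<in> F" using a b exp_dvd_antisym by blast
qed

text \<open>The minimal exponents give a generating set contained in every monomial generating set.
  Such a least set is the only inclusion-minimal one, which justifies \<open>THE\<close> in
  \<open>min_gens\<close>.\<close>

lemma is_min_gens_iff:
  assumes E: "E \<subseteq> exps n"
  shows "is_min_gens n (mon_span n E) S \<longleftrightarrow> S = (xpow ` min_exps E :: ((nat \<Rightarrow>\<^sub>0 nat) \<Rightarrow>\<^sub>0 'k::field) set)"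
proof
  have sub: "min_exps E \<subseteq> exps n" using E by (auto simp: min_exps_def)
  have Idl_min: "Idl\<^bsub>poly_ring n\<^esub> (xpow ` min_exps E) = (mon_span n E :: ((nat \<Rightarrow>\<^sub>0 nat) \<Rightarrow>\<^sub>0 'k) set)"
    using Idl_xpow[OF sub, where 'k = 'k] mon_span_min_exps[OF E, where 'k = 'k] by simp
  have least: "xpow ` min_exps E \<subseteq> T"
    if T: "T \<subseteq> monomials n" "Idl\<^bsub>poly_ring n\<^esub> T = mon_span n E"
    for T :: "((nat \<Rightarrow>\<^sub>0 nat) \<Rightarrow>\<^sub>0 'k) set"
  proof -
    obtain F where F: "F \<subseteq> exps n" "T = xpow ` F"
      using T(1) unfolding monomials_eq by (auto simp: subset_image_iff)
    then have "mon_span n E = (mon_span n F :: ((nat \<Rightarrow>\<^sub>0 nat) \<Rightarrow>\<^sub>0 'k) set)"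
      using T(2) Idl_xpow[OF F(1), where 'k = 'k] by simp
    then show ?thesis using min_exps_subset[OF E F(1)] F(2) by blast
  qed
  {
    assume "is_min_gens n (mon_span n E) S"
    then show "S = xpow ` min_exps E"
      using least[of S] Idl_min unfolding is_min_gens_def by blast
  next
    assume "S = xpow ` min_exps E"
    moreover have "xpow ` min_exps E \<subseteq> monomials n"
      unfolding monomials_eq using sub by (rule image_mono)
    ultimately show "is_min_gens n (mon_span n E) S"
      unfolding is_min_gens_def using Idl_min least by (metis order_trans psubset_eq subset_antisym)
  }
qed

lemma min_gens_mon_span:
  assumes "E \<subseteq> exps n"
  shows "min_gens n (mon_span n E) = (xpow ` min_exps E :: ((nat \<Rightarrow>\<^sub>0 nat) \<Rightarrow>\<^sub>0 'k::field) set)"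
  unfolding min_gens_def is_min_gens_iff[OF assms] by simp

section \<open>Divisibility by variables and supports\<close>

lemma var_divides_xpow:
  assumes "e \<in> exps n"
  shows "var i divides\<^bsub>poly_ring n\<^esub> (xpow e :: (nat \<Rightarrow>\<^sub>0 nat) \<Rightarrow>\<^sub>0 'k::field) \<longleftrightarrow> i \<in> Poly_Mapping.keys e"
proof
  have var: "var i = (xpow (Poly_Mapping.single i 1) :: (nat \<Rightarrow>\<^sub>0 nat) \<Rightarrow>\<^sub>0 'k)"
    by (simp add: var_def xpow_def)
  {
    assume "var i divides\<^bsub>poly_ring n\<^esub> (xpow e :: (nat \<Rightarrow>\<^sub>0 nat) \<Rightarrow>\<^sub>0 'k)"
    then obtain c where "(xpow e :: (nat \<Rightarrow>\<^sub>0 nat) \<Rightarrow>\<^sub>0 'k) = xpow (Poly_Mapping.single i 1) * c"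
      by (auto simp: factor_def var poly_ring_simps)
    \<comment> \<open>The cofactor \<open>c\<close> may be any polynomial of the ring, so only
      exponents are compared: every exponent of the product is at least 1 at
      \<open>i\<close>.\<close>
    then have "e \<in> Poly_Mapping.keys ((xpow (Poly_Mapping.single i 1) :: (nat \<Rightarrow>\<^sub>0 nat) \<Rightarrow>\<^sub>0 'k) * c)"
      by (metis keys_xpow singletonI)
    then obtain d where "e = Poly_Mapping.single i 1 + d"
      using keys_mult[of "xpow (Poly_Mapping.single i 1) :: (nat \<Rightarrow>\<^sub>0 nat) \<Rightarrow>\<^sub>0 'k" c] by auto
    then show "i \<in> Poly_Mapping.keys e"
      by (simp add: in_keys_iff lookup_add)
  next
    assume i: "i \<in> Poly_Mapping.keys e"
    then have "Poly_Mapping.single i 1 \<preceq> e"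
      by (auto simp: exp_dvd_def lookup_single when_def in_keys_iff)
    then have "(xpow e :: (nat \<Rightarrow>\<^sub>0 nat) \<Rightarrow>\<^sub>0 'k) = var i * xpow (e - Poly_Mapping.single i 1)"
      using exp_dvd_diff_add[of "Poly_Mapping.single i 1" e] by (simp add: var xpow_mult add.commute)
    then show "var i divides\<^bsub>poly_ring n\<^esub> (xpow e :: (nat \<Rightarrow>\<^sub>0 nat) \<Rightarrow>\<^sub>0 'k)"
      unfolding factor_def poly_ring_simps
      using exps_diff[OF assms] by (intro bexI) (auto simp: carrier_poly_ring)
  }
qed

lemma supp_xpow:
  assumes "E \<subseteq> exps n"
  shows "supp n (xpow ` E :: ((nat \<Rightarrow>\<^sub>0 nat) \<Rightarrow>\<^sub>0 'k::field) set) = (\<Union>e\<in>E. Poly_Mapping.keys e)"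
proof -
  have "var i divides\<^bsub>poly_ring n\<^esub> (xpow e :: (nat \<Rightarrow>\<^sub>0 nat) \<Rightarrow>\<^sub>0 'k) \<longleftrightarrow> i \<in> Poly_Mapping.keys e"
    if "e \<in> E" for e i
    using var_divides_xpow that assms by blast
  moreover have "Poly_Mapping.keys e \<subseteq> {1..n}" if "e \<in> E" for e
    using that assms by (auto simp: exps_def)
  ultimately show ?thesis
    unfolding supp_def by blast
qed

section \<open>Products of monomial ideals\<close>

lemma ideal_prod_mon_span:
  assumes E: "E \<subseteq> exps n" and F: "F \<subseteq> exps n"
  shows "mon_span n E \<cdot>\<^bsub>poly_ring n\<^esub> mon_span n F =
    (mon_span n {a + b |a b. a \<in> E \<and> b \<in> F} :: ((nat \<Rightarrow>\<^sub>0 nat) \<Rightarrow>\<^sub>0 'k::field) set)"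
    (is "?P = ?S")
proof
  interpret ring "poly_ring n :: ((nat \<Rightarrow>\<^sub>0 nat) \<Rightarrow>\<^sub>0 'k) ring" by (rule poly_ring_ring)
  show "?P \<subseteq> ?S"
  proof
    fix p assume "p \<in> ?P"
    \<comment> \<open>The ideal product is the closure of the products \<open>x * y\<close> under
      addition, so two cases arise.\<close>
    then show "p \<in> ?S"
    proof (induction rule: ideal_prod.induct)
      case (prod x y)
      have "x * y \<in> carrier (poly_ring n)"
        using m_closed[of x y] prod by (simp add: mon_span_def poly_ring_simps)
      moreover have "\<exists>a\<in>{a + b |a b. a \<in> E \<and> b \<in> F}. a \<preceq> e" if e: "e \<in> Poly_Mapping.keys (x * y)" for e
      proof -
        obtain c d where cd: "e = c + d" "c \<in> Poly_Mapping.keys x" "d \<in> Poly_Mapping.keys y"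
          using e keys_mult[of x y] by blast
        obtain a b where ab: "a \<in> E" "b \<in> F" "a \<preceq> c" "b \<preceq> d"
          using cd prod unfolding mon_span_def by blast
        then have "a + b \<preceq> e"
          by (simp add: cd exp_dvd_def lookup_add add_mono)
        then show ?thesis using ab by blast
      qed
      ultimately show ?case by (simp add: mon_span_def poly_ring_simps)
    next
      case (sum x y)
      then show ?case by (simp add: poly_ring_simps mon_span_add)
    qed
  qed
  show "?S \<subseteq> ?P"
  proof (rule mon_span_subset_ideal)
    show "ideal ?P (poly_ring n)"
      by (rule ideal_prod_is_ideal[OF ideal_mon_span ideal_mon_span])
    have "(xpow (a + b) :: (nat \<Rightarrow>\<^sub>0 nat) \<Rightarrow>\<^sub>0 'k) \<in> ?P" if "a \<in> E" "b \<in> F" for a b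
    proof -
      have "(xpow a :: (nat \<Rightarrow>\<^sub>0 nat) \<Rightarrow>\<^sub>0 'k) \<in> mon_span n E" "(xpow b :: (nat \<Rightarrow>\<^sub>0 nat) \<Rightarrow>\<^sub>0 'k) \<in> mon_span n F"
        using that E F by (auto intro: xpow_in_span_self)
      from ideal_prod.prod[OF this, of "poly_ring n"] show ?thesis
        by (simp add: poly_ring_simps xpow_mult)
    qed
    then show "xpow ` {a + b |a b. a \<in> E \<and> b \<in> F} \<subseteq> ?P" by blast
  qed
qed

text \<open>Encodes an ideal and its minimal generators by one set of exponents; the antichain
  property is the form in which minimality is used.\<close>

lemma monomial_ideal_antichain:
  fixes I :: "((nat \<Rightarrow>\<^sub>0 nat) \<Rightarrow>\<^sub>0 'k::field) set"
  assumes "monomial_ideal n I"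
  obtains G where "G \<subseteq> exps n" "I = mon_span n G" "min_gens n I = xpow ` G"
    "\<And>a b. a \<in> G \<Longrightarrow> b \<in> G \<Longrightarrow> a \<preceq> b \<Longrightarrow> a = b"
proof -
  obtain E where E: "E \<subseteq> exps n" "I = Idl\<^bsub>poly_ring n\<^esub> (xpow ` E)"
    using assms unfolding monomial_ideal_def monomials_eq by (auto simp: subset_image_iff)
  then have I: "I = mon_span n E" by (simp add: Idl_xpow)
  show thesis
  proof (rule that)
    show "min_exps E \<subseteq> exps n" using E(1) by (auto simp: min_exps_def)
    show "I = mon_span n (min_exps E)" using I mon_span_min_exps[OF E(1), where 'k = 'k] by simp
    show "min_gens n I = xpow ` min_exps E" using I min_gens_mon_span[OF E(1), where 'k = 'k] by simp
  qed (rule min_exps_antichain)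
qed

theorem theorem2p2:
  fixes n :: nat and I J :: "((nat \<Rightarrow>\<^sub>0 nat) \<Rightarrow>\<^sub>0 'k::field) set"
  assumes "monomial_ideal n I" and "monomial_ideal n J"
  shows "I \<inter> J = I \<cdot>\<^bsub>poly_ring n\<^esub> J \<longleftrightarrow> supp n (min_gens n I) \<inter> supp n (min_gens n J) = {}"
proof -
  interpret ring "poly_ring n :: ((nat \<Rightarrow>\<^sub>0 nat) \<Rightarrow>\<^sub>0 'k) ring" by (rule poly_ring_ring)
  obtain G where G: "G \<subseteq> exps n" "I = mon_span n G" "min_gens n I = xpow ` G"
    "\<And>a b. a \<in> G \<Longrightarrow> b \<in> G \<Longrightarrow> a \<preceq> b \<Longrightarrow> a = b"
    using monomial_ideal_antichain[OF assms(1)] by blast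
  obtain H where H: "H \<subseteq> exps n" "J = mon_span n H" "min_gens n J = xpow ` H"
    "\<And>a b. a \<in> H \<Longrightarrow> b \<in> H \<Longrightarrow> a \<preceq> b \<Longrightarrow> a = b"
    using monomial_ideal_antichain[OF assms(2)] by blast
  have prod: "I \<cdot>\<^bsub>poly_ring n\<^esub> J = mon_span n {a + b |a b. a \<in> G \<and> b \<in> H}"
    using ideal_prod_mon_span[OF G(1) H(1)] G(2) H(2) by simp
  have le: "I \<cdot>\<^bsub>poly_ring n\<^esub> J \<subseteq> I \<inter> J"
    using ideal_prod_inter[OF ideal_mon_span ideal_mon_span] G(2) H(2) by simp
  \<comment> \<open>Each support is the union of the variable sets of the generators, so
    disjointness means that all pairs are coprime.\<close>
  have supp: "supp n (min_gens n I) \<inter> supp n (min_gens n J) = {} \<longleftrightarrow>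
      (\<forall>u\<in>G. \<forall>v\<in>H. Poly_Mapping.keys u \<inter> Poly_Mapping.keys v = {})"
    unfolding G(3) H(3) supp_xpow[OF G(1)] supp_xpow[OF H(1)] by blast
  show ?thesis
    unfolding supp
  proof (intro iffI ballI)
    fix u v assume eq: "I \<inter> J = I \<cdot>\<^bsub>poly_ring n\<^esub> J" and uv: "u \<in> G" "v \<in> H"
    \<comment> \<open>The lcm is a multiple of a generator of each ideal, so its monomial lies in
      the intersection; by \<open>eq\<close> and \<open>prod\<close> a product of generators divides
      it.\<close>
    have lcm: "\<exists>u'\<in>G. \<exists>v'\<in>H. u' + v' \<preceq> exp_lcm u v" if "u \<in> G" "v \<in> H" for u v
    proof -
      have "(xpow (exp_lcm u v) :: (nat \<Rightarrow>\<^sub>0 nat) \<Rightarrow>\<^sub>0 'k) \<in> I \<inter> J"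
        using that G(1) H(1) unfolding G(2) H(2)
        by (blast intro: xpow_in_spanI exps_lcm exp_dvd_lcm)
      then show ?thesis unfolding eq prod by (auto simp: xpow_in_span)
    qed
    show "Poly_Mapping.keys u \<inter> Poly_Mapping.keys v = {}"
      using G(4) H(4) lcm uv by (rule antichains_disjoint_keys)
  next
    assume disj: "\<forall>u\<in>G. \<forall>v\<in>H. Poly_Mapping.keys u \<inter> Poly_Mapping.keys v = {}"
    have "I \<inter> J \<subseteq> I \<cdot>\<^bsub>poly_ring n\<^esub> J"
    proof
      fix p assume p: "p \<in> I \<inter> J"
      \<comment> \<open>Each exponent of \<open>p\<close> lies above a generator from either side;
        these are coprime, so it also lies above their sum.\<close>
      have "\<exists>c\<in>{a + b |a b. a \<in> G \<and> b \<in> H}. c \<preceq> e" if e: "e \<in> Poly_Mapping.keys p" for e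
      proof -
        obtain a b where "a \<in> G" "b \<in> H" "a \<preceq> e" "b \<preceq> e"
          using p e unfolding G(2) H(2) mon_span_def by blast
        then show ?thesis using disj exp_dvd_add_coprime by blast
      qed
      then show "p \<in> I \<cdot>\<^bsub>poly_ring n\<^esub> J"
        using p G(2) unfolding prod by (simp add: mon_span_def)
    qed
    then show "I \<inter> J = I \<cdot>\<^bsub>poly_ring n\<^esub> J" using le by blast
  qed
qed

end
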